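(* Let $n\ge1$ and let $H\subset GL_n$ be the torus of diagonal matrices. The trigonometric Casimir connection of $\mathfrak{gl}_n$, i.e. the $Y(\mathfrak{gl}_n)$-valued connection on $H_{\mathrm{reg}}$ $$\nabla=d-\sum_{1\le i<j\le n}\frac{d(\theta_i-\theta_j)}{e^{\theta_i-\theta_j}-1}\,\kappa_{\theta_i-\theta_j}-\sum_{i=1}^nd\theta_i\,D_i,\qquad D_i=2t_{ii}^{(2)}-\sum_{j<i}\kappa_{\theta_j-\theta_i}-E_{ii}^2,$$ is flat and equivariant under the symmetric group $\mathfrak S_n$.
   Context: $Y(\mathfrak{gl}_n)$ is the unital associative $\mathbb C$-algebra generated by $t_{ij}^{(r)}$, $1\le i,j\le n$, $r\ge1$, with relations $[t_{ij}^{(r+1)},t_{kl}^{(s)}]-[t_{ij}^{(r)},t_{kl}^{(s+1)}]=t_{kj}^{(r)}t_{il}^{(s)}-t_{kj}^{(s)}t_{il}^{(r)}$ for $r,s\in\mathbb N=\{0,1,\dots\}$, where $t_{ij}^{(0)}=\delta_{ij}$. The map $E_{ij}\mapsto t_{ij}^{(1)}$ embeds $\mathfrak{gl}_n$ (with elementary matrix basis $E_{ij}$) in $Y(\mathfrak{gl}_n)$, and $\mathfrak{gl}_n$ is identified with its image. $\theta_a$ is the linear form on diagonal matrices given by $\theta_a(E_{bb})=\delta_{ab}$; $e^{\theta_a}$ is the $a$-th diagonal entry as a function on $H$, and $d\theta_a$ is the corresponding translation-invariant one-form. For $a\neq b$, $\kappa_{\theta_a-\theta_b}=E_{ab}E_{ba}+E_{ba}E_{ab}$.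 $H_{\mathrm{reg}}\subset H$ is the set of diagonal matrices with distinct diagonal entries. $\mathfrak S_n$ acts on $Y(\mathfrak{gl}_n)$ by the algebra automorphisms $\sigma(t_{ij}^{(r)})=t_{\sigma(i)\sigma(j)}^{(r)}$ and on $H$ by permuting the diagonal entries. Writing $\nabla=d-\omega$, equivariance means that $\omega$ is invariant under the simultaneous action of each $\sigma\in\mathfrak S_n$ on $Y(\mathfrak{gl}_n)$ and on forms on $H_{\mathrm{reg}}$ (with $d\theta_i\mapsto d\theta_{\sigma(i)}$, $e^{\theta_i}\mapsto e^{\theta_{\sigma(i)}}$). *)

theory Defs
  imports "HOL-Analysis.Analysis" "HOL-Combinatorics.Perm"
begin

section \<open>The Yangian of $gl_n$\<close>

text \<open>
  The index set \<open>{1,\<dots>,n}\<close> is a nonempty finite linearly ordered type \<open>'n\<close>, with \<open>n = CARD('n)\<close>.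

  The algebra is built from its presentation: formal noncommutative polynomial expressions in the
  symbols \<open>t\<^sub>i\<^sub>j\<^sup>(\<^sup>r\<^sup>)\<close> modulo the least congruence that contains the axioms of unital associative
  complex algebras and the defining relations. The symbols with \<open>r = 0\<close> are kept as expressions
  and identified with the scalars \<open>\<delta>\<^sub>i\<^sub>j\<close>.
\<close>

datatype 'n yterm =
    YGen 'n 'n nat
  | YConst complex
  | YAdd "'n yterm" "'n yterm"
  | YMul "'n yterm" "'n yterm"

abbreviation YNeg :: "'n yterm \<Rightarrow> 'n yterm" where
  "YNeg x \<equiv> YMul (YConst (-1)) x"

abbreviation YDiff :: "'n yterm \<Rightarrow> 'n yterm \<Rightarrow> 'n yterm" where
  "YDiff x y \<equiv> YAdd x (YNeg y)"

abbreviation YComm :: "'n yterm \<Rightarrow> 'n yterm \<Rightarrow> 'n yterm" where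
  "YComm x y \<equiv> YDiff (YMul x y) (YMul y x)"

inductive yeq :: "'n yterm \<Rightarrow> 'n yterm \<Rightarrow> bool" where
  yeq_refl: "yeq x x"
| yeq_sym: "yeq x y \<Longrightarrow> yeq y x"
| yeq_trans: "yeq x y \<Longrightarrow> yeq y z \<Longrightarrow> yeq x z"
| yeq_cong_add: "yeq x x' \<Longrightarrow> yeq y y' \<Longrightarrow> yeq (YAdd x y) (YAdd x' y')"
| yeq_cong_mul: "yeq x x' \<Longrightarrow> yeq y y' \<Longrightarrow> yeq (YMul x y) (YMul x' y')"
| yeq_add_assoc: "yeq (YAdd (YAdd x y) z) (YAdd x (YAdd y z))"
| yeq_add_commute: "yeq (YAdd x y) (YAdd y x)"
| yeq_add_zero: "yeq (YAdd (YConst 0) x) x"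
| yeq_add_neg: "yeq (YAdd (YNeg x) x) (YConst 0)"
| yeq_mul_assoc: "yeq (YMul (YMul x y) z) (YMul x (YMul y z))"
| yeq_mul_one: "yeq (YMul (YConst 1) x) x"
| yeq_distrib_right: "yeq (YMul (YAdd x y) z) (YAdd (YMul x z) (YMul y z))"
| yeq_distrib_left: "yeq (YMul x (YAdd y z)) (YAdd (YMul x y) (YMul x z))"
| yeq_const_add: "yeq (YConst (a + b)) (YAdd (YConst a) (YConst b))"
| yeq_const_mul: "yeq (YConst (a * b)) (YMul (YConst a) (YConst b))"
| yeq_const_central: "yeq (YMul (YConst c) x) (YMul x (YConst c))"
| yeq_gen_zero: "yeq (YGen i j 0) (YConst (if i = j then 1 else 0))"
| yeq_yangian:
    "yeq (YDiff (YComm (YGen i j (r + 1)) (YGen k l s)) (YComm (YGen i j r) (YGen k l (s + 1))))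
         (YDiff (YMul (YGen k j r) (YGen i l s)) (YMul (YGen k j s) (YGen i l r)))"

lemma equivp_yeq: "equivp yeq"
  by (intro equivpI reflpI sympI transpI) (auto intro: yeq_refl yeq_sym yeq_trans)

quotient_type 'n yangian = "'n yterm" / yeq
  by (rule equivp_yeq)

primrec yaug :: "'n yterm \<Rightarrow> complex" where
  "yaug (YGen i j r) = (if r = 0 \<and> i = j then 1 else 0)"
| "yaug (YConst c) = c"
| "yaug (YAdd x y) = yaug x + yaug y"
| "yaug (YMul x y) = yaug x * yaug y"

lemma yeq_imp_yaug_eq: "yeq x y \<Longrightarrow> yaug x = yaug y"
  by (induction rule: yeq.induct) (auto simp: algebra_simps)

instantiation yangian :: (type) ring_1
begin

lift_definition zero_yangian :: "'a yangian" is "YConst 0" .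
lift_definition one_yangian :: "'a yangian" is "YConst 1" .
lift_definition plus_yangian :: "'a yangian \<Rightarrow> 'a yangian \<Rightarrow> 'a yangian" is YAdd
  by (rule yeq_cong_add)
lift_definition times_yangian :: "'a yangian \<Rightarrow> 'a yangian \<Rightarrow> 'a yangian" is YMul
  by (rule yeq_cong_mul)
lift_definition uminus_yangian :: "'a yangian \<Rightarrow> 'a yangian" is YNeg
  by (rule yeq_cong_mul[OF yeq_refl])
lift_definition minus_yangian :: "'a yangian \<Rightarrow> 'a yangian \<Rightarrow> 'a yangian" is YDiff
  by (intro yeq_cong_add yeq_cong_mul yeq_refl)

instance
proof
  fix a b c :: "'a yangian"
  show "a + b + c = a + (b + c)" by transfer (rule yeq_add_assoc)
  show "a + b = b + a" by transfer (rule yeq_add_commute)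
  show "0 + a = a" by transfer (rule yeq_add_zero)
  show "- a + a = 0" by transfer (rule yeq_add_neg)
  show "a - b = a + - b" by transfer (rule yeq_refl)
  show "a * b * c = a * (b * c)" by transfer (rule yeq_mul_assoc)
  show "1 * a = a" by transfer (rule yeq_mul_one)
  show "a * 1 = a" by transfer (metis yeq_const_central yeq_mul_one yeq_sym yeq_trans)
  show "(a + b) * c = a * c + b * c" by transfer (rule yeq_distrib_right)
  show "a * (b + c) = a * b + a * c" by transfer (rule yeq_distrib_left)
  show "(0 :: 'a yangian) \<noteq> 1" by transfer (auto dest: yeq_imp_yaug_eq)
qed

end

lift_definition yconst :: "complex \<Rightarrow> 'n yangian" is YConst .

lift_definition ygen :: "'n \<Rightarrow> 'n \<Rightarrow> nat \<Rightarrow> 'n yangian" is YGen .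

definition yscale :: "complex \<Rightarrow> 'n yangian \<Rightarrow> 'n yangian" (infixr \<open>\<cdot>\<^sub>Y\<close> 75) where
  "c \<cdot>\<^sub>Y y = yconst c * y"

lemma yconst_add: "yconst (a + b) = yconst a + yconst b"
  by transfer (rule yeq_const_add)

lemma yconst_mult: "yconst (a * b) = yconst a * yconst b"
  by transfer (rule yeq_const_mul)

lemma yconst_central: "yconst c * y = y * yconst c"
  by transfer (rule yeq_const_central)

lemma yconst_one: "yconst 1 = 1"
  by transfer (rule yeq_refl)

lemma ygen_zero: "ygen i j 0 = yconst (if i = j then 1 else 0)"
  by transfer (rule yeq_gen_zero)

definition comm :: "'a::ring \<Rightarrow> 'a \<Rightarrow> 'a" where
  "comm x y = x * y - y * x"

lemma ygen_relation:
  "comm (ygen i j (r + 1)) (ygen k l s) - comm (ygen i j r) (ygen k l (s + 1)) =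
     ygen k j r * ygen i l s - ygen k j s * ygen i l r"
  unfolding comm_def by transfer (rule yeq_yangian)

interpretation yangian: vector_space yscale
  by unfold_locales
     (simp_all add: yscale_def yconst_add yconst_mult yconst_one algebra_simps)

section \<open>The action of the symmetric group on the Yangian\<close>

lemma yeq_map_yterm:
  assumes "inj f" "yeq x y"
  shows "yeq (map_yterm f x) (map_yterm f y)"
  using assms(2)
proof (induction rule: yeq.induct)
  case (yeq_gen_zero i j)
  then show ?case
    using assms(1) yeq.yeq_gen_zero[of "f i" "f j"] by (auto simp: inj_eq)
next
  case (yeq_yangian i j r k l s)
  show ?case
    using yeq.yeq_yangian[of "f i" "f j" r "f k" "f l" s] by simp
qed (simp_all, (rule yeq.intros; assumption)+)

lift_definition perm_yangian :: "'n Perm.perm \<Rightarrow> 'n yangian \<Rightarrow> 'n yangian" is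
  "\<lambda>\<sigma>. map_yterm (Perm.apply \<sigma>)"
  by (simp add: yeq_map_yterm bij_is_inj)

lemma perm_yangian_ygen:
  "perm_yangian \<sigma> (ygen i j r) = ygen (Perm.apply \<sigma> i) (Perm.apply \<sigma> j) r"
  by transfer (simp add: yeq_refl)

lemma perm_yangian_yconst: "perm_yangian \<sigma> (yconst c) = yconst c"
  by transfer (simp add: yeq_refl)

lemma perm_yangian_add: "perm_yangian \<sigma> (x + y) = perm_yangian \<sigma> x + perm_yangian \<sigma> y"
  by transfer (simp add: yeq_refl)

lemma perm_yangian_mult: "perm_yangian \<sigma> (x * y) = perm_yangian \<sigma> x * perm_yangian \<sigma> y"
  by transfer (simp add: yeq_refl)

section \<open>The torus\<close>

definition diagonal_matrices :: "(complex^'n^'n) set" where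
  "diagonal_matrices = {X. \<forall>i j. i \<noteq> j \<longrightarrow> X $ i $ j = 0}"

definition torus :: "(complex^'n^'n) set" where
  "torus = {h \<in> diagonal_matrices. invertible h}"

definition torus_reg :: "(complex^'n^'n) set" where
  "torus_reg = {h \<in> torus. inj (\<lambda>i. h $ i $ i)}"

definition theta :: "'n \<Rightarrow> complex^'n^'n \<Rightarrow> complex" where
  "theta a X = X $ a $ a"

definition exp_theta :: "'n \<Rightarrow> complex^'n^'n \<Rightarrow> complex" where
  "exp_theta a h = h $ a $ a"

text \<open>
  The torus is open in the space of diagonal matrices, which is therefore its tangent space at each
  point. A one-form sends a point \<open>h\<close> and a tangent vector \<open>X\<close> to its value. The
  translation-invariant form \<open>d\<theta>\<^sub>a\<close> is \<open>\<theta>\<^sub>a\<close> at the identity, and translation by \<open>h\<^sup>-\<^sup>1\<close> takes \<open>X\<close>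
  at \<open>h\<close> to \<open>h\<^sup>-\<^sup>1 X\<close> at the identity.
\<close>

definition dtheta :: "'n::finite \<Rightarrow> complex^'n^'n \<Rightarrow> complex^'n^'n \<Rightarrow> complex" where
  "dtheta a h X = theta a (matrix_inv h ** X)"

lemma torus_entry_nonzero:
  fixes h :: "complex^'n^'n"
  assumes "h \<in> torus"
  shows "h $ a $ a \<noteq> 0"
proof -
  have "det h = (\<Prod>i\<in>UNIV. h $ i $ i)"
    using assms by (intro det_diagonal) (auto simp: torus_def diagonal_matrices_def)
  moreover have "det h \<noteq> 0"
    using assms by (simp add: torus_def invertible_det_nz)
  ultimately show ?thesis by auto
qed

lemma dtheta_eq:
  fixes h :: "complex^'n^'n"
  assumes "h \<in> torus"
  shows "dtheta a h X = X $ a $ a / h $ a $ a"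
proof -
  have diag: "h $ i $ j = 0" if "i \<noteq> j" for i j
    using assms that by (simp add: torus_def diagonal_matrices_def)
  have "h ** matrix_inv h = mat 1"
    using assms unfolding torus_def invertible_def matrix_inv_def by (auto intro: someI2_ex)
  then have "h ** (matrix_inv h ** X) = X"
    by (simp add: matrix_mul_assoc)
  then have "X $ a $ a = (h ** (matrix_inv h ** X)) $ a $ a"
    by simp
  also have "\<dots> = (\<Sum>k\<in>UNIV. h $ a $ k * (matrix_inv h ** X) $ k $ a)"
    by (simp add: matrix_matrix_mult_def)
  also have "\<dots> = (\<Sum>k\<in>{a}. h $ a $ k * (matrix_inv h ** X) $ k $ a)"
    by (rule sum.mono_neutral_right) (auto simp: diag)
  finally show ?thesis
    using torus_entry_nonzero[OF assms, of a] by (simp add: dtheta_def theta_def field_simps)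
qed

section \<open>Forms and connections with values in the Yangian\<close>

type_synonym 'n yfunction = "complex^'n^'n \<Rightarrow> 'n yangian"
type_synonym 'n yform1 = "complex^'n^'n \<Rightarrow> complex^'n^'n \<Rightarrow> 'n yangian"
type_synonym 'n yform2 = "complex^'n^'n \<Rightarrow> complex^'n^'n \<Rightarrow> complex^'n^'n \<Rightarrow> 'n yangian"

text \<open>
  The Yangian is infinite-dimensional and carries no topology here. Functions on the regular
  torus with values in it are elements of the algebraic tensor product of scalar functions with the
  Yangian, that is finite sums \<open>\<Sum>\<^sub>k f\<^sub>k y\<^sub>k\<close>, and are differentiated coefficientwise:
  the derivative at \<open>h\<close> along \<open>X\<close> is \<open>\<Sum>\<^sub>k f\<^sub>k'(h; X) y\<^sub>k\<close>, with complex derivatives along the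
  line \<open>h + z X\<close> (the matrix \<open>mat z\<close> is \<open>z\<close> times the identity). The value does not
  depend on the chosen sum; see \<open>has_directional_derivative_unique\<close>.
\<close>

definition has_directional_derivative ::
    "'n::finite yfunction \<Rightarrow> complex^'n^'n \<Rightarrow> complex^'n^'n \<Rightarrow> 'n yangian \<Rightarrow> bool" where
  "has_directional_derivative F h X D \<longleftrightarrow>
     (\<exists>(m::nat) f d y.
        (\<forall>g\<in>torus_reg. F g = (\<Sum>k<m. f k g \<cdot>\<^sub>Y y k)) \<and>
        (\<forall>k<m. ((\<lambda>z. f k (h + mat z ** X)) has_field_derivative d k) (at 0)) \<and>
        D = (\<Sum>k<m. d k \<cdot>\<^sub>Y y k))"

lemma torus_iff:
  fixes h :: "complex^'n^'n"
  shows "h \<in> torus \<longleftrightarrow> h \<in> diagonal_matrices \<and> (\<forall>i. h $ i $ i \<noteq> 0)"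
proof (cases "h \<in> diagonal_matrices")
  case True
  then have "det h = (\<Prod>i\<in>UNIV. h $ i $ i)"
    by (intro det_diagonal) (auto simp: diagonal_matrices_def)
  then show ?thesis
    using True by (simp add: torus_def invertible_det_nz)
qed (simp add: torus_def)

lemma mat_mult_component: "(mat z ** X) $ i $ j = z * X $ i $ j"
  for X :: "complex^'n^'n"
proof -
  have "(mat z ** X) $ i $ j = (\<Sum>k\<in>UNIV. (if i = k then z * X $ k $ j else 0))"
    unfolding matrix_matrix_mult_def mat_def
    by (simp add: if_distrib[of "\<lambda>u. u * _"] cong: if_cong)
  then show ?thesis by simp
qed

lemma eventually_line_in_torus_reg:
  fixes h :: "complex^'n^'n"
  assumes h: "h \<in> torus_reg" and X: "X \<in> diagonal_matrices"
  shows "\<forall>\<^sub>F z in nhds 0. h + mat z ** X \<in> torus_reg"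
proof -
  let ?c = "\<lambda>i z. h $ i $ i + z * X $ i $ i"
  have cont: "((\<lambda>z. ?c i z) \<longlongrightarrow> ?c i 0) (nhds 0)" for i
    by (rule iffD1[OF tendsto_at_iff_tendsto_nhds]) (intro tendsto_intros)
  have hh: "h \<in> torus" "inj (\<lambda>i. h $ i $ i)"
    using h by (auto simp: torus_reg_def)
  have "\<forall>\<^sub>F z in nhds 0. ?c i z \<noteq> 0" for i
    using tendsto_imp_eventually_ne[OF cont[of i], of 0] hh(1) by (simp add: torus_iff)
  then have 1: "\<forall>\<^sub>F z in nhds 0. \<forall>i. ?c i z \<noteq> 0"
    by (simp add: eventually_all_finite)
  have "\<forall>\<^sub>F z in nhds 0. i \<noteq> j \<longrightarrow> ?c i z \<noteq> ?c j z" for i j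
  proof (cases "i = j")
    case False
    have "((\<lambda>z. ?c i z - ?c j z) \<longlongrightarrow> ?c i 0 - ?c j 0) (nhds 0)"
      by (intro tendsto_diff cont)
    from tendsto_imp_eventually_ne[OF this, of 0] show ?thesis
      using False inj_eq[OF hh(2), of i j] by simp
  qed simp
  then have 2: "\<forall>\<^sub>F z in nhds 0. \<forall>i j. i \<noteq> j \<longrightarrow> ?c i z \<noteq> ?c j z"
    by (simp add: eventually_all_finite)
  from 1 2 show ?thesis
  proof eventually_elim
    case (elim z)
    have "h + mat z ** X \<in> diagonal_matrices"
      using hh(1) X by (auto simp: torus_def diagonal_matrices_def mat_mult_component)
    with elim show ?case
      by (auto simp: torus_reg_def torus_iff mat_mult_component inj_on_def)
  qed
qed

lemma has_directional_derivative_unique: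
  fixes h :: "complex^'n^'n"
  assumes h: "h \<in> torus_reg" and X: "X \<in> diagonal_matrices"
    and D: "has_directional_derivative F h X D" and E: "has_directional_derivative F h X E"
  shows "D = E"
proof -
  define B where "B = yangian.extend_basis ({} :: 'n yangian set)"
  have B: "yangian.independent B" "yangian.span B = UNIV"
    unfolding B_def using yangian.independent_extend_basis[of "{}"]
      yangian.span_extend_basis[of "{}"] yangian.independent_empty by auto
  define rep where "rep = yangian.representation B"
  have rep_sum: "rep (\<Sum>k<m. c k \<cdot>\<^sub>Y y k) b = (\<Sum>k<m. c k * rep (y k) b)"
    for m :: nat and c and y :: "nat \<Rightarrow> 'n yangian" and b
    unfolding rep_def
    using B by (simp add: yangian.representation_sum yangian.representation_scale)
  have deriv: "((\<lambda>z. rep (F (h + mat z ** X)) b) has_field_derivative rep D' b) (at 0)"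
    if D': "has_directional_derivative F h X D'" for D' b
  proof -
    obtain m :: nat and f d y where
      F: "\<forall>g\<in>torus_reg. F g = (\<Sum>k<m. f k g \<cdot>\<^sub>Y y k)" and
      f: "\<forall>k<m. ((\<lambda>z. f k (h + mat z ** X)) has_field_derivative d k) (at 0)" and
      D'_eq: "D' = (\<Sum>k<m. d k \<cdot>\<^sub>Y y k)"
      using D' unfolding has_directional_derivative_def by blast
    have "((\<lambda>z. \<Sum>k<m. f k (h + mat z ** X) * rep (y k) b) has_field_derivative
            (\<Sum>k<m. d k * rep (y k) b)) (at 0)"
      using f by (intro DERIV_sum DERIV_cmult_right) auto
    moreover have "\<forall>\<^sub>F z in nhds 0.
        (\<Sum>k<m. f k (h + mat z ** X) * rep (y k) b) = rep (F (h + mat z ** X)) b"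
      using eventually_line_in_torus_reg[OF h X]
      by eventually_elim (simp add: F rep_sum)
    ultimately show ?thesis
      unfolding D'_eq rep_sum using DERIV_cong_ev by fastforce
  qed
  have "rep D b = rep E b" for b
    by (rule DERIV_unique[OF deriv[OF D] deriv[OF E]])
  then have "rep D = rep E" ..
  moreover have "(\<Sum>b | rep x b \<noteq> 0. rep x b \<cdot>\<^sub>Y b) = x" for x
    unfolding rep_def using B by (intro yangian.sum_nonzero_representation_eq) auto
  ultimately show ?thesis by metis
qed

definition directional_derivative ::
    "'n::finite yfunction \<Rightarrow> complex^'n^'n \<Rightarrow> complex^'n^'n \<Rightarrow> 'n yangian" where
  "directional_derivative F h X = (THE D. has_directional_derivative F h X D)"

lemma directional_derivative_eq:
  fixes h :: "complex^'n^'n"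
  assumes "h \<in> torus_reg" "X \<in> diagonal_matrices" "has_directional_derivative F h X D"
  shows "directional_derivative F h X = D"
  unfolding directional_derivative_def
  using assms by (blast intro: the_equality has_directional_derivative_unique)

definition holomorphic_form1 :: "'n::finite yform1 \<Rightarrow> bool" where
  "holomorphic_form1 \<omega> \<longleftrightarrow>
     (\<forall>h\<in>torus_reg. \<forall>X\<in>diagonal_matrices. \<forall>Z\<in>diagonal_matrices.
        \<omega> h (X + Z) = \<omega> h X + \<omega> h Z \<and>
        (\<forall>c. \<omega> h (mat c ** X) = c \<cdot>\<^sub>Y \<omega> h X) \<and>
        (\<exists>D. has_directional_derivative (\<lambda>g. \<omega> g X) h Z D))"

text \<open>The constant vector fields \<open>X\<close> and \<open>Z\<close> commute, so no bracket term is needed.\<close>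

definition exterior_derivative :: "'n::finite yform1 \<Rightarrow> 'n yform2" where
  "exterior_derivative \<omega> h X Z =
     directional_derivative (\<lambda>g. \<omega> g Z) h X - directional_derivative (\<lambda>g. \<omega> g X) h Z"

definition wedge :: "'n yform1 \<Rightarrow> 'n yform1 \<Rightarrow> 'n yform2" where
  "wedge \<omega> \<eta> h X Z = \<omega> h X * \<eta> h Z - \<omega> h Z * \<eta> h X"

text \<open>The curvature of the connection \<open>d - \<omega>\<close> is \<open>(d - \<omega>)\<^sup>2 = - d\<omega> + \<omega> \<and> \<omega>\<close>.\<close>

definition curvature :: "'n::finite yform1 \<Rightarrow> 'n yform2" where
  "curvature \<omega> h X Z = - exterior_derivative \<omega> h X Z + wedge \<omega> \<omega> h X Z"

definition flat_connection :: "'n::finite yform1 \<Rightarrow> bool" where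
  "flat_connection \<omega> \<longleftrightarrow> holomorphic_form1 \<omega> \<and>
     (\<forall>h\<in>torus_reg. \<forall>X\<in>diagonal_matrices. \<forall>Z\<in>diagonal_matrices. curvature \<omega> h X Z = 0)"

text \<open>
  On diagonal matrices, permuting the entries moves the \<open>i\<close>-th diagonal entry to place \<open>\<sigma> i\<close>.
\<close>

definition perm_matrix_act :: "'n Perm.perm \<Rightarrow> complex^'n^'n \<Rightarrow> complex^'n^'n" where
  "perm_matrix_act \<sigma> h =
     (\<chi> i j. h $ Perm.apply (inverse \<sigma>) i $ Perm.apply (inverse \<sigma>) j)"

text \<open>
  A permutation acts on forms by pullback along its inverse, which takes \<open>d\<theta>\<^sub>i\<close> to \<open>d\<theta>\<^sub>\<sigma>\<^sub>(\<^sub>i\<^sub>)\<close> and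
  \<open>e\<^sup>\<theta>\<^sup>i\<close> to the exponential of \<open>\<theta>\<^sub>\<sigma>\<^sub>(\<^sub>i\<^sub>)\<close>. The action on the torus is the restriction of
  a linear map, which is its own differential.
\<close>

definition perm_form_act :: "'n Perm.perm \<Rightarrow> 'n::finite yform1 \<Rightarrow> 'n yform1" where
  "perm_form_act \<sigma> \<omega> h X =
     perm_yangian \<sigma> (\<omega> (perm_matrix_act (inverse \<sigma>) h) (perm_matrix_act (inverse \<sigma>) X))"

lemma apply_inverse_inverse: "Perm.apply (inverse (inverse \<sigma>)) = Perm.apply \<sigma>"
  by (simp add: apply_inverse inv_inv_eq)

lemma exp_theta_perm:
  "exp_theta i (perm_matrix_act (inverse \<sigma>) h) = exp_theta (Perm.apply \<sigma> i) h"
  by (simp add: exp_theta_def perm_matrix_act_def apply_inverse_inverse)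

lemma perm_matrix_act_torus:
  fixes h :: "complex^'n^'n"
  assumes "h \<in> torus"
  shows "perm_matrix_act \<sigma> h \<in> torus"
  using assms bij_is_inj[OF bij_apply[of "inverse \<sigma>"]]
  by (auto simp: torus_iff diagonal_matrices_def perm_matrix_act_def inj_eq)

lemma dtheta_perm:
  fixes h :: "complex^'n^'n"
  assumes "h \<in> torus"
  shows "dtheta i (perm_matrix_act (inverse \<sigma>) h) (perm_matrix_act (inverse \<sigma>) X) =
           dtheta (Perm.apply \<sigma> i) h X"
  using assms perm_matrix_act_torus[OF assms, of "inverse \<sigma>"]
  by (simp add: dtheta_eq perm_matrix_act_def apply_inverse_inverse)

definition equivariant_connection :: "'n::finite yform1 \<Rightarrow> bool" where
  "equivariant_connection \<omega> \<longleftrightarrow>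
     (\<forall>\<sigma>. \<forall>h\<in>torus_reg. \<forall>X\<in>diagonal_matrices. perm_form_act \<sigma> \<omega> h X = \<omega> h X)"

section \<open>The trigonometric Casimir connection\<close>

definition gl_unit :: "'n \<Rightarrow> 'n \<Rightarrow> 'n yangian" where
  "gl_unit a b = ygen a b 1"

text \<open>\<open>kappa a b\<close> is attached to the root \<open>\<theta>\<^sub>a - \<theta>\<^sub>b\<close> and is used only for \<open>a \<noteq> b\<close>.\<close>

definition kappa :: "'n \<Rightarrow> 'n \<Rightarrow> 'n yangian" where
  "kappa a b = gl_unit a b * gl_unit b a + gl_unit b a * gl_unit a b"

definition casimir_D :: "'n::{finite,linorder} \<Rightarrow> 'n yangian" where
  "casimir_D i = 2 \<cdot>\<^sub>Y ygen i i 2 - (\<Sum>j | j < i. kappa j i) - (gl_unit i i)\<^sup>2"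

text \<open>The form \<open>\<omega>\<close> for which the trigonometric Casimir connection is \<open>d - \<omega>\<close>.\<close>

definition trig_casimir_form :: "'n::{finite,linorder} yform1" where
  "trig_casimir_form h X =
     (\<Sum>(i, j) | i < j.
        ((dtheta i h X - dtheta j h X) / (exp_theta i h / exp_theta j h - 1)) \<cdot>\<^sub>Y kappa i j) +
     (\<Sum>i\<in>UNIV. dtheta i h X \<cdot>\<^sub>Y casimir_D i)"

end

theory Submission
  imports Defs
begin

text \<open>
  Write \<open>u\<^sub>i = e\<^sup>\<theta>\<^sup>i\<close> for the diagonal entries of a point of the regular torus, and put
  \<open>r\<^sub>i\<^sub>j = u\<^sub>j / (u\<^sub>i - u\<^sub>j)\<close>. For \<open>i < j\<close> the form \<open>\<omega>\<close> contains \<open>r\<^sub>i\<^sub>j (d\<theta>\<^sub>i - d\<theta>\<^sub>j) \<kappa>\<^sub>i\<^sub>j\<close>, and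
  \<open>- r\<^sub>i\<^sub>j = r\<^sub>j\<^sub>i + 1\<close>. The extra \<open>d\<theta>\<^sub>j \<kappa>\<^sub>i\<^sub>j\<close> cancels the sum subtracted in \<open>D\<^sub>j\<close>, and what
  remains no longer depends on the order of the indices (\<open>trig_casimir_form_eq\<close>):
  \<open>\<omega> = \<Sum>\<^sub>i d\<theta>\<^sub>i A\<^sub>i\<close>, where \<open>A\<^sub>i = T\<^sub>i + \<Sum>\<^sub>j\<^sub>\<noteq>\<^sub>i r\<^sub>i\<^sub>j \<kappa>\<^sub>i\<^sub>j\<close> and \<open>T\<^sub>i = 2 t\<^sub>i\<^sub>i\<^sup>(\<^sup>2\<^sup>) - E\<^sub>i\<^sub>i\<^sup>2\<close>.
  A permutation \<open>\<sigma>\<close> carries each ingredient with indices \<open>i, j\<close> to the one with indices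
  \<open>\<sigma> i, \<sigma> j\<close>, so equivariance is a reindexing of the sums.

  The form is closed because \<open>\<partial>r\<^sub>i\<^sub>j/\<partial>\<theta>\<^sub>j = u\<^sub>i u\<^sub>j / (u\<^sub>i - u\<^sub>j)\<^sup>2\<close> and \<open>\<kappa>\<^sub>i\<^sub>j\<close> are both symmetric in
  \<open>i\<close> and \<open>j\<close>. Flatness is then the pointwise statement that the \<open>A\<^sub>i\<close> commute
  (\<open>comm_trig_casimir_component\<close>), in which two kinds of terms cancel separately:

  \<^item> With \<open>w = 4 (E\<^sub>k\<^sub>i t\<^sub>i\<^sub>k\<^sup>(\<^sup>2\<^sup>) - t\<^sub>k\<^sub>i\<^sup>(\<^sup>2\<^sup>) E\<^sub>i\<^sub>k)\<close>, the Yangian relations give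
    \<open>[T\<^sub>i, T\<^sub>k] = [T\<^sub>i, \<kappa>\<^sub>i\<^sub>k] = [\<kappa>\<^sub>i\<^sub>k, T\<^sub>k] = w\<close>, and \<open>T\<^sub>i\<close> commutes with \<open>\<kappa>\<^sub>k\<^sub>j\<close> for \<open>i\<close> distinct
    from \<open>j\<close> and \<open>k\<close>. The total is \<open>(1 + r\<^sub>k\<^sub>i + r\<^sub>i\<^sub>k) w = 0\<close>.
  \<^item> The elements \<open>\<kappa>\<close> satisfy \<open>[\<kappa>\<^sub>i\<^sub>j, \<kappa>\<^sub>i\<^sub>k + \<kappa>\<^sub>j\<^sub>k] = 0\<close> for distinct indices, so for each \<open>j\<close> other than \<open>i\<close> and
    \<open>k\<close> the three commutators among \<open>\<kappa>\<^sub>i\<^sub>j\<close>, \<open>\<kappa>\<^sub>j\<^sub>k\<close>, \<open>\<kappa>\<^sub>i\<^sub>k\<close> agree up to sign. Their combined coefficient vanishes by the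
    partial fraction identity \<open>r\<^sub>i\<^sub>j r\<^sub>k\<^sub>j = r\<^sub>i\<^sub>k r\<^sub>k\<^sub>j + r\<^sub>i\<^sub>j r\<^sub>k\<^sub>i\<close>.
\<close>

section \<open>Commutators\<close>

lemma comm_add_left: "comm (x + y) z = comm x z + comm y z"
  and comm_add_right: "comm x (y + z) = comm x y + comm x z"
  and comm_diff_left: "comm (x - y) z = comm x z - comm y z"
  and comm_diff_right: "comm x (y - z) = comm x y - comm x z"
  by (simp_all add: comm_def algebra_simps)

lemma comm_mult_left: "comm (x * y) z = x * comm y z + comm x z * y"
  and comm_mult_right: "comm x (y * z) = comm x y * z + y * comm x z"
  by (simp_all add: comm_def algebra_simps)

lemma comm_swap: "comm y x = - comm x y"
  by (simp add: comm_def)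

lemma comm_self: "comm x x = 0"
  by (simp add: comm_def)

lemma comm_sum_left: "comm (sum f A) y = (\<Sum>i\<in>A. comm (f i) y)"
  and comm_sum_right: "comm y (sum f A) = (\<Sum>i\<in>A. comm y (f i))"
  by (simp_all add: comm_def sum_distrib_left sum_distrib_right sum_subtractf)

lemma mult_yscale_right: "x * (c \<cdot>\<^sub>Y y) = c \<cdot>\<^sub>Y (x * y)"
  unfolding yscale_def by (metis mult.assoc yconst_central)

lemma mult_yscale_left: "(c \<cdot>\<^sub>Y x) * y = c \<cdot>\<^sub>Y (x * y)"
  by (simp add: yscale_def mult.assoc)

lemma yscale_2: "2 \<cdot>\<^sub>Y x = x + x"
  using yangian.scale_left_distrib[of 1 1 x] by simp

lemma comm_yscale_left: "comm (c \<cdot>\<^sub>Y x) y = c \<cdot>\<^sub>Y comm x y"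
  and comm_yscale_right: "comm x (c \<cdot>\<^sub>Y y) = c \<cdot>\<^sub>Y comm x y"
  by (simp_all add: comm_def mult_yscale_left mult_yscale_right yangian.scale_right_diff_distrib)

section \<open>Commutation relations in the Yangian\<close>

lemma yconst_0: "yconst 0 = 0"
  by transfer (rule yeq_refl)

text \<open>The defining relation at \<open>r = 0\<close>, where the generators of degree zero are scalars.\<close>

lemma comm_gl_unit_ygen:
  "comm (gl_unit i j) (ygen k l s) =
     (if k = j then ygen i l s else 0) - (if i = l then ygen k j s else 0)"
proof -
  have "comm (ygen i j 0) (ygen k l (s + 1)) = 0"
    by (simp add: ygen_zero comm_def yconst_central)
  then show ?thesis
    using ygen_relation[of i j 0 k l s]
    by (auto simp: gl_unit_def ygen_zero yconst_one yconst_0)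
qed

lemma comm_gl_unit:
  "comm (gl_unit i j) (gl_unit k l) =
     (if k = j then gl_unit i l else 0) - (if i = l then gl_unit k j else 0)"
  using comm_gl_unit_ygen[of i j k l 1] by (simp add: gl_unit_def)

lemma comm_ygen_gl_unit:
  "comm (ygen k l s) (gl_unit i j) =
     (if i = l then ygen k j s else 0) - (if k = j then ygen i l s else 0)"
  by (subst comm_swap) (simp add: comm_gl_unit_ygen)

text \<open>
  This is the relation at \<open>r = 1\<close>, \<open>s = 2\<close>; its second commutator \<open>[E\<^sub>i\<^sub>i, t\<^sub>k\<^sub>k\<^sup>(\<^sup>3\<^sup>)]\<close> is zero.
\<close>

lemma comm_ygen_2_diagonal:
  assumes "i \<noteq> k"
  shows "comm (ygen i i 2) (ygen k k 2) = gl_unit k i * ygen i k 2 - ygen k i 2 * gl_unit i k"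
proof -
  have "comm (ygen i i 1) (ygen k k 3) = 0"
    using comm_gl_unit_ygen[of i i k k 3] assms by (simp add: gl_unit_def)
  then show ?thesis
    using ygen_relation[of i i 1 k k 2]
    by (simp add: gl_unit_def numeral_2_eq_2 numeral_3_eq_3)
qed

lemma kappa_commute: "kappa a b = kappa b a"
  by (simp add: kappa_def add.commute)

text \<open>
  The element \<open>\<kappa>\<^sub>a\<^sub>k + \<kappa>\<^sub>b\<^sub>k\<close> is invariant under the copy of \<open>gl\<^sub>2\<close> with indices \<open>a, b\<close>: it pairs
  its vector representation spanned by \<open>E\<^sub>a\<^sub>k, E\<^sub>b\<^sub>k\<close> with the dual one spanned by \<open>E\<^sub>k\<^sub>a, E\<^sub>k\<^sub>b\<close>.
\<close>

lemma comm_gl_unit_kappa_sum: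
  assumes "a \<noteq> b" "a \<noteq> k" "b \<noteq> k"
  shows "comm (gl_unit a b) (kappa a k + kappa b k) = 0"
  using assms by (simp add: kappa_def comm_add_right comm_mult_right comm_gl_unit)

lemma comm_kappa_kappa_sum:
  assumes "a \<noteq> b" "a \<noteq> k" "b \<noteq> k"
  shows "comm (kappa a b) (kappa a k + kappa b k) = 0"
proof -
  have "comm (gl_unit a b) (kappa a k + kappa b k) = 0"
       "comm (gl_unit b a) (kappa a k + kappa b k) = 0"
    using assms comm_gl_unit_kappa_sum[of a b k] comm_gl_unit_kappa_sum[of b a k]
    by (simp_all add: add.commute)
  then show ?thesis
    by (subst kappa_def) (simp add: comm_add_left comm_mult_left)
qed

lemma comm_kappa_disjoint:
  assumes "a \<noteq> c" "a \<noteq> d" "b \<noteq> c" "b \<noteq> d"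
  shows "comm (kappa a b) (kappa c d) = 0"
  using assms
  by (simp add: kappa_def comm_add_right comm_mult_right comm_add_left comm_mult_left comm_gl_unit)

text \<open>
  The Yangian elements in the component of the connection form along \<open>d\<theta>\<^sub>i\<close>: the elements
  \<open>\<kappa>\<^sub>i\<^sub>j\<close> for \<open>j \<noteq> i\<close> and, as the diagonal case \<open>j = i\<close>, the term
  \<open>T\<^sub>i = 2 t\<^sub>i\<^sub>i\<^sup>(\<^sup>2\<^sup>) - E\<^sub>i\<^sub>i\<^sup>2\<close> of \<open>D\<^sub>i\<close>. Putting both into one family makes each component a single
  sum over all \<open>j\<close>.
\<close>

definition trig_casimir_elt :: "'n \<Rightarrow> 'n \<Rightarrow> 'n yangian" where
  "trig_casimir_elt i j =
     (if i = j then 2 \<cdot>\<^sub>Y ygen i i 2 - (gl_unit i i)\<^sup>2 else kappa i j)"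

lemma trig_casimir_elt_commute: "trig_casimir_elt i j = trig_casimir_elt j i"
  by (simp add: trig_casimir_elt_def kappa_commute)

lemma comm_elt_diagonal_kappa_disjoint:
  assumes "i \<noteq> k" "i \<noteq> j"
  shows "comm (trig_casimir_elt i i) (kappa k j) = 0"
  using assms
  by (simp add: trig_casimir_elt_def kappa_def power2_eq_square comm_add_right comm_diff_left
      comm_mult_right comm_yscale_left comm_ygen_gl_unit comm_mult_left comm_gl_unit)

lemma comm_elt_diagonal_kappa:
  assumes "i \<noteq> k"
  shows "comm (trig_casimir_elt i i) (kappa i k) =
     4 \<cdot>\<^sub>Y (gl_unit k i * ygen i k 2 - ygen k i 2 * gl_unit i k)"
proof -
  have "comm (gl_unit i i) (kappa i k) = 0"
    using assms by (simp add: kappa_def comm_add_right comm_mult_right comm_gl_unit)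
  then have sq: "comm (gl_unit i i * gl_unit i i) (kappa i k) = 0"
    by (simp add: comm_mult_left)
  \<comment> \<open>Both commutators equal \<open>t\<^sub>i\<^sub>i\<^sup>(\<^sup>2\<^sup>) - t\<^sub>k\<^sub>k\<^sup>(\<^sup>2\<^sup>)\<close>, so they cancel in the difference below.\<close>
  have "ygen i k 2 * gl_unit k i = gl_unit k i * ygen i k 2 + comm (ygen i k 2) (gl_unit k i)"
    "gl_unit i k * ygen k i 2 = ygen k i 2 * gl_unit i k + comm (gl_unit i k) (ygen k i 2)"
    by (simp_all add: comm_def)
  then have "comm (ygen i i 2) (kappa i k) =
      2 \<cdot>\<^sub>Y (gl_unit k i * ygen i k 2 - ygen k i 2 * gl_unit i k)"
    using assms
    by (simp add: yscale_2 kappa_def comm_add_right comm_mult_right comm_ygen_gl_unit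
        comm_gl_unit_ygen)
  then show ?thesis
    using sq by (simp add: trig_casimir_elt_def power2_eq_square comm_diff_left comm_yscale_left)
qed

lemma comm_elt_diagonal:
  assumes "i \<noteq> k"
  shows "comm (trig_casimir_elt i i) (trig_casimir_elt k k) =
     4 \<cdot>\<^sub>Y (gl_unit k i * ygen i k 2 - ygen k i 2 * gl_unit i k)"
  using assms
  by (simp add: trig_casimir_elt_def power2_eq_square comm_diff_left comm_diff_right
      comm_yscale_left comm_yscale_right comm_mult_left comm_mult_right comm_ygen_gl_unit
      comm_gl_unit_ygen comm_gl_unit comm_ygen_2_diagonal)

section \<open>The components of the connection form\<close>

text \<open>
  The function multiplying \<open>trig_casimir_elt i j\<close>, which is \<open>1 / (e\<^sup>\<theta>\<^sup>i / e\<^sup>\<theta>\<^sup>j - 1)\<close> for \<open>i \<noteq> j\<close> and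
  \<open>1\<close> for the diagonal term. Unlike in the definition of the connection, \<open>i > j\<close> is allowed.
\<close>

definition trig_casimir_coeff :: "'n \<Rightarrow> 'n \<Rightarrow> complex^'n^'n \<Rightarrow> complex" where
  "trig_casimir_coeff i j h =
     (if i = j then 1 else h $ j $ j / (h $ i $ i - h $ j $ j))"

text \<open>The coefficient \<open>A\<^sub>i\<close> of \<open>d\<theta>\<^sub>i\<close> in the connection form, as a function on the torus.\<close>

definition trig_casimir_component :: "'n::finite \<Rightarrow> complex^'n^'n \<Rightarrow> 'n yangian" where
  "trig_casimir_component i h =
     (\<Sum>j\<in>UNIV. trig_casimir_coeff i j h \<cdot>\<^sub>Y trig_casimir_elt i j)"

lemma torus_reg_entry_neq:
  "h \<in> torus_reg \<Longrightarrow> i \<noteq> j \<Longrightarrow> h $ i $ i \<noteq> h $ j $ j"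
  by (auto simp: torus_reg_def dest: injD)

lemma torus_reg_imp_torus: "h \<in> torus_reg \<Longrightarrow> h \<in> torus"
  by (simp add: torus_reg_def)

lemma trig_casimir_coeff_add:
  assumes "h \<in> torus_reg" "i \<noteq> k"
  shows "trig_casimir_coeff i k h + trig_casimir_coeff k i h = -1"
  using torus_reg_entry_neq[OF assms] assms(2)
  by (simp add: trig_casimir_coeff_def divide_simps) (simp add: algebra_simps)

lemma trig_casimir_coeff_triple:
  assumes "h \<in> torus_reg" "i \<noteq> j" "j \<noteq> k" "i \<noteq> k"
  shows "trig_casimir_coeff i j h * trig_casimir_coeff k j h =
     trig_casimir_coeff i k h * trig_casimir_coeff k j h +
     trig_casimir_coeff i j h * trig_casimir_coeff k i h"
  using assms(2-) torus_reg_entry_neq[OF assms(1,2)] torus_reg_entry_neq[OF assms(1,3)]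
    torus_reg_entry_neq[OF assms(1,4)]
  by (simp add: trig_casimir_coeff_def divide_simps) (simp add: algebra_simps)

text \<open>
  For \<open>i \<noteq> k\<close> the proof separates the index pair \<open>i, k\<close> from the rest:
  \<open>A\<^sub>i = T\<^sub>i + r\<^sub>i\<^sub>k \<kappa>\<^sub>i\<^sub>k + B\<^sub>i\<close> and \<open>A\<^sub>k = T\<^sub>k + r\<^sub>k\<^sub>i \<kappa>\<^sub>i\<^sub>k + B\<^sub>k\<close>, where \<open>B\<^sub>i\<close> and \<open>B\<^sub>k\<close> involve only
  indices \<open>j\<close> different from both.
\<close>

lemma comm_trig_casimir_component:
  fixes h :: "complex^'n::finite^'n"
  assumes h: "h \<in> torus_reg"
  shows "comm (trig_casimir_component i h) (trig_casimir_component k h) = 0"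
proof (cases "i = k")
  case False
  define J where "J = UNIV - {i, k}"
  define r where "r = (\<lambda>a b. trig_casimir_coeff a b h)"
  define T where "T = (\<lambda>a::'n. trig_casimir_elt a a)"
  define B where "B = (\<lambda>a. \<Sum>j\<in>J. r a j \<cdot>\<^sub>Y kappa a j)"
  define w where "w = 4 \<cdot>\<^sub>Y (gl_unit k i * ygen i k 2 - ygen k i 2 * gl_unit i k)"
  have split: "sum f UNIV = f i + f k + sum f J" for f :: "'n \<Rightarrow> 'n yangian"
  proof -
    have "UNIV = insert i (insert k J)" by (auto simp: J_def)
    then have "sum f UNIV = sum f (insert i (insert k J))" by simp
    also have "\<dots> = f i + f k + sum f J"
      using False by (subst sum.insert; (simp add: J_def add.assoc))
    finally show ?thesis .
  qed
  have Ai: "trig_casimir_component i h = T i + r i k \<cdot>\<^sub>Y kappa i k + B i"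
    unfolding trig_casimir_component_def split
    using False
    by (auto simp: T_def r_def B_def trig_casimir_coeff_def trig_casimir_elt_def J_def
        intro!: sum.cong)
  have Ak: "trig_casimir_component k h = T k + r k i \<cdot>\<^sub>Y kappa i k + B k"
    unfolding trig_casimir_component_def split
    using False
    by (auto simp: T_def r_def B_def trig_casimir_coeff_def trig_casimir_elt_def J_def
        kappa_commute[of k i] add.commute intro!: sum.cong split: if_splits)
  have TT: "comm (T i) (T k) = w"
    unfolding T_def w_def by (rule comm_elt_diagonal[OF False])
  have T\<kappa>: "comm (T i) (kappa i k) = w"
    unfolding T_def w_def by (rule comm_elt_diagonal_kappa[OF False])
  have "comm (T k) (kappa i k) = 4 \<cdot>\<^sub>Y (gl_unit i k * ygen k i 2 - ygen i k 2 * gl_unit k i)"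
    unfolding T_def using comm_elt_diagonal_kappa[of k i] False by (simp add: kappa_commute)
  also have "gl_unit i k * ygen k i 2 - ygen i k 2 * gl_unit k i =
     comm (gl_unit i k) (ygen k i 2) - comm (ygen i k 2) (gl_unit k i)
       - (gl_unit k i * ygen i k 2 - ygen k i 2 * gl_unit i k)"
    by (simp add: comm_def)
  also have "\<dots> = - (gl_unit k i * ygen i k 2 - ygen k i 2 * gl_unit i k)"
    by (simp add: comm_gl_unit_ygen comm_ygen_gl_unit)
  finally have \<kappa>T: "comm (kappa i k) (T k) = w"
    by (subst comm_swap) (simp add: w_def yangian.scale_right_diff_distrib)
  have TB: "comm (T i) (B k) = 0"
    unfolding B_def comm_sum_right T_def
    using False
    by (intro sum.neutral)
       (auto simp: J_def comm_yscale_right comm_elt_diagonal_kappa_disjoint)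
  have "comm (T k) (B i) = 0"
    unfolding B_def comm_sum_right T_def
    using False
    by (intro sum.neutral)
       (auto simp: J_def comm_yscale_right comm_elt_diagonal_kappa_disjoint)
  then have BT: "comm (B i) (T k) = 0"
    by (subst comm_swap) simp
  \<comment> \<open>Only equal indices contribute: for \<open>j \<noteq> l\<close> the pairs \<open>i, j\<close> and \<open>k, l\<close> are disjoint.\<close>
  have BB: "comm (B i) (B k) = (\<Sum>j\<in>J. (r i j * r k j) \<cdot>\<^sub>Y comm (kappa i j) (kappa k j))"
  proof -
    have "(\<Sum>l\<in>J. comm (r i j \<cdot>\<^sub>Y kappa i j) (r k l \<cdot>\<^sub>Y kappa k l)) =
      (r i j * r k j) \<cdot>\<^sub>Y comm (kappa i j) (kappa k j)" if j: "j \<in> J" for j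
    proof -
      have "comm (r i j \<cdot>\<^sub>Y kappa i j) (r k l \<cdot>\<^sub>Y kappa k l) = 0" if "l \<in> J - {j}" for l
        using that j False
        by (auto simp: J_def comm_yscale_left comm_yscale_right comm_kappa_disjoint)
      then have "(\<Sum>l\<in>J. comm (r i j \<cdot>\<^sub>Y kappa i j) (r k l \<cdot>\<^sub>Y kappa k l)) =
          (\<Sum>l\<in>{j}. comm (r i j \<cdot>\<^sub>Y kappa i j) (r k l \<cdot>\<^sub>Y kappa k l))"
        using j by (intro sum.mono_neutral_right) auto
      then show ?thesis
        by (simp add: comm_yscale_left comm_yscale_right)
    qed
    moreover have "comm (B i) (B k) =
        (\<Sum>j\<in>J. \<Sum>l\<in>J. comm (r i j \<cdot>\<^sub>Y kappa i j) (r k l \<cdot>\<^sub>Y kappa k l))"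
      unfolding B_def by (subst comm_sum_left) (simp only: comm_sum_right)
    ultimately show ?thesis
      by simp
  qed
  have "r i k \<cdot>\<^sub>Y comm (kappa i k) (B k) + r k i \<cdot>\<^sub>Y comm (B i) (kappa i k) + comm (B i) (B k) =
    (\<Sum>j\<in>J. (r i k * r k j) \<cdot>\<^sub>Y comm (kappa i k) (kappa k j) +
       (r i j * r k i) \<cdot>\<^sub>Y comm (kappa i j) (kappa i k) +
       (r i j * r k j) \<cdot>\<^sub>Y comm (kappa i j) (kappa k j))"
    unfolding BB
    by (simp add: B_def comm_sum_left comm_sum_right comm_yscale_left comm_yscale_right
        yangian.scale_sum_right sum.distrib mult.commute)
  also have "\<dots> = 0"
  proof (rule sum.neutral, rule ballI)
    fix j assume "j \<in> J"
    then have j: "i \<noteq> j" "j \<noteq> k" by (auto simp: J_def)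
    define c where "c = comm (kappa i j) (kappa k j)"
    have 1: "comm (kappa i j) (kappa i k) = - c"
      using comm_kappa_kappa_sum[of i j k] j False
      by (simp add: c_def comm_add_right kappa_commute[of j k] eq_neg_iff_add_eq_0)
    have "comm (kappa k j) (kappa i k) = c"
      using comm_kappa_kappa_sum[of k j i] j False comm_swap[of "kappa k j" "kappa i j"]
      by (simp add: c_def comm_add_right kappa_commute[of j i] kappa_commute[of k i])
    then have 2: "comm (kappa i k) (kappa k j) = - c"
      by (subst comm_swap) simp
    show "(r i k * r k j) \<cdot>\<^sub>Y comm (kappa i k) (kappa k j) +
       (r i j * r k i) \<cdot>\<^sub>Y comm (kappa i j) (kappa i k) +
       (r i j * r k j) \<cdot>\<^sub>Y comm (kappa i j) (kappa k j) = 0"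
      unfolding 1 2 c_def[symmetric]
      using trig_casimir_coeff_triple[OF h j False]
      by (simp add: r_def yangian.scale_left_distrib yangian.scale_minus_right)
  qed
  finally have \<kappa>\<kappa>_sum: "r i k \<cdot>\<^sub>Y comm (kappa i k) (B k) + r k i \<cdot>\<^sub>Y comm (B i) (kappa i k) +
    comm (B i) (B k) = 0" .
  have "r k i \<cdot>\<^sub>Y w + r i k \<cdot>\<^sub>Y w = (-1) \<cdot>\<^sub>Y w"
    using trig_casimir_coeff_add[OF h False]
    by (simp add: r_def yangian.scale_left_distrib[symmetric] add.commute)
  then have TT_sum: "w + r k i \<cdot>\<^sub>Y w + r i k \<cdot>\<^sub>Y w = 0"
    by (simp add: add.assoc)
  have "comm (trig_casimir_component i h) (trig_casimir_component k h) =
      (w + r k i \<cdot>\<^sub>Y w + r i k \<cdot>\<^sub>Y w) +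
      (r i k \<cdot>\<^sub>Y comm (kappa i k) (B k) + r k i \<cdot>\<^sub>Y comm (B i) (kappa i k) + comm (B i) (B k))"
    unfolding Ai Ak
    by (simp add: comm_add_left comm_add_right comm_yscale_left comm_yscale_right
        yangian.scale_right_distrib TT T\<kappa> \<kappa>T TB BT comm_self add_ac)
  then show ?thesis
    by (simp only: TT_sum \<kappa>\<kappa>_sum add_0_left)
qed (simp add: comm_self)

text \<open>The expression for the connection form that is free of the order on the indices.\<close>

lemma trig_casimir_form_eq:
  fixes h :: "complex^('n::{finite,linorder})^('n::{finite,linorder})"
  assumes h: "h \<in> torus_reg"
  shows "trig_casimir_form h X =
    (\<Sum>i\<in>UNIV. (X $ i $ i / h $ i $ i) \<cdot>\<^sub>Y trig_casimir_component i h)"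
proof -
  define x where "x = (\<lambda>i. X $ i $ i / h $ i $ i)"
  define r where "r = (\<lambda>i j. trig_casimir_coeff i j h)"
  define T where "T = (\<lambda>i::'n. trig_casimir_elt i i)"
  have x: "dtheta i h X = x i" for i
    using dtheta_eq[OF torus_reg_imp_torus[OF h]] by (simp add: x_def)
  have coeff: "(x i - x j) / (exp_theta i h / exp_theta j h - 1) = x i * r i j + x j * r j i + x j"
    if "i < j" for i j
  proof -
    have "h $ i $ i \<noteq> h $ j $ j" "h $ j $ j \<noteq> 0"
      using torus_reg_entry_neq[OF h, of i j] that
        torus_entry_nonzero[OF torus_reg_imp_torus[OF h]] by auto
    then have "1 / (exp_theta i h / exp_theta j h - 1) = r i j"
      using that by (simp add: r_def trig_casimir_coeff_def exp_theta_def divide_simps)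
    moreover have "- r i j = r j i + 1"
      using trig_casimir_coeff_add[OF h less_imp_neq[OF that]]
      by (simp add: r_def algebra_simps eq_neg_iff_add_eq_0 neg_eq_iff_add_eq_0)
    moreover have "(x i - x j) / q = x i * (1 / q) + x j * (- (1 / q))" for q
      by (simp add: diff_divide_distrib)
    ultimately show ?thesis
      by (simp only: distrib_left mult_1_right add.assoc)
  qed
  have pairs: "(\<Sum>(i, j) | i < j. F i j) = (\<Sum>i\<in>UNIV. \<Sum>j\<in>UNIV. if i < j then F i j else 0)"
    for F :: "'n \<Rightarrow> 'n \<Rightarrow> 'n yangian"
    unfolding sum.cartesian_product
    by (rule sum.mono_neutral_cong_left) (auto split: if_splits)
  have "trig_casimir_form h X =
      (\<Sum>(i, j) | i < j. (x i * r i j + x j * r j i + x j) \<cdot>\<^sub>Y kappa i j) +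
      (\<Sum>i\<in>UNIV. x i \<cdot>\<^sub>Y casimir_D i)"
    unfolding trig_casimir_form_def x
    by (intro arg_cong2[where f = "(+)"] sum.cong refl) (auto simp: coeff)
  also have "(\<Sum>(i, j) | i < j. (x i * r i j + x j * r j i + x j) \<cdot>\<^sub>Y kappa i j) =
      (\<Sum>i\<in>UNIV. \<Sum>j\<in>UNIV. if i < j then (x i * r i j) \<cdot>\<^sub>Y kappa i j else 0) +
      (\<Sum>i\<in>UNIV. \<Sum>j\<in>UNIV. if i < j then (x j * r j i) \<cdot>\<^sub>Y kappa i j else 0) +
      (\<Sum>i\<in>UNIV. \<Sum>j\<in>UNIV. if i < j then x j \<cdot>\<^sub>Y kappa i j else 0)"
    unfolding pairs sum.distrib[symmetric]
    by (intro sum.cong refl) (simp add: yangian.scale_left_distrib)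
  also have "(\<Sum>i\<in>UNIV. \<Sum>j\<in>UNIV. if i < j then (x j * r j i) \<cdot>\<^sub>Y kappa i j else 0) =
      (\<Sum>i\<in>UNIV. \<Sum>j\<in>UNIV. if j < i then (x i * r i j) \<cdot>\<^sub>Y kappa i j else 0)"
    by (subst sum.swap, intro sum.cong refl) (simp add: kappa_commute)
  also have "(\<Sum>i\<in>UNIV. \<Sum>j\<in>UNIV. if i < j then x j \<cdot>\<^sub>Y kappa i j else 0) =
      (\<Sum>i\<in>UNIV. x i \<cdot>\<^sub>Y (\<Sum>j | j < i. kappa j i))"
  proof (subst sum.swap, rule sum.cong[OF refl])
    fix i
    show "(\<Sum>j\<in>UNIV. if j < i then x i \<cdot>\<^sub>Y kappa j i else 0) = x i \<cdot>\<^sub>Y (\<Sum>j | j < i. kappa j i)"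
      unfolding yangian.scale_sum_right
      by (rule sum.mono_neutral_cong_right) auto
  qed
  also have "(\<Sum>i\<in>UNIV. x i \<cdot>\<^sub>Y casimir_D i) =
      (\<Sum>i\<in>UNIV. x i \<cdot>\<^sub>Y T i) - (\<Sum>i\<in>UNIV. x i \<cdot>\<^sub>Y (\<Sum>j | j < i. kappa j i))"
    unfolding sum_subtractf[symmetric]
    by (intro sum.cong refl)
       (simp add: casimir_D_def T_def trig_casimir_elt_def
         yangian.scale_right_diff_distrib algebra_simps)
  also have "(\<Sum>i\<in>UNIV. x i \<cdot>\<^sub>Y T i) =
      (\<Sum>i\<in>UNIV. \<Sum>j\<in>UNIV. if j = i then (x i * r i j) \<cdot>\<^sub>Y trig_casimir_elt i j else 0)"
    by (simp add: T_def r_def trig_casimir_coeff_def)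
  also have "(\<Sum>i\<in>UNIV. \<Sum>j\<in>UNIV. if i < j then (x i * r i j) \<cdot>\<^sub>Y kappa i j else 0) +
      (\<Sum>i\<in>UNIV. \<Sum>j\<in>UNIV. if j < i then (x i * r i j) \<cdot>\<^sub>Y kappa i j else 0) +
      (\<Sum>i\<in>UNIV. x i \<cdot>\<^sub>Y (\<Sum>j | j < i. kappa j i)) +
      ((\<Sum>i\<in>UNIV. \<Sum>j\<in>UNIV. if j = i then (x i * r i j) \<cdot>\<^sub>Y trig_casimir_elt i j else 0) -
      (\<Sum>i\<in>UNIV. x i \<cdot>\<^sub>Y (\<Sum>j | j < i. kappa j i))) =
      (\<Sum>i\<in>UNIV. \<Sum>j\<in>UNIV. if i < j then (x i * r i j) \<cdot>\<^sub>Y kappa i j else 0) +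
      (\<Sum>i\<in>UNIV. \<Sum>j\<in>UNIV. if j < i then (x i * r i j) \<cdot>\<^sub>Y kappa i j else 0) +
      (\<Sum>i\<in>UNIV. \<Sum>j\<in>UNIV. if j = i then (x i * r i j) \<cdot>\<^sub>Y trig_casimir_elt i j else 0)"
    by simp
  also have "\<dots> = (\<Sum>i\<in>UNIV. \<Sum>j\<in>UNIV. (x i * r i j) \<cdot>\<^sub>Y trig_casimir_elt i j)"
    unfolding sum.distrib[symmetric]
    by (intro sum.cong refl) (auto simp: trig_casimir_elt_def)
  finally show ?thesis
    by (simp add: trig_casimir_component_def yangian.scale_sum_right x_def r_def)
qed

corollary trig_casimir_form_eq_double_sum:
  fixes h :: "complex^('n::{finite,linorder})^('n::{finite,linorder})"
  assumes "h \<in> torus_reg"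
  shows "trig_casimir_form h X =
    (\<Sum>(i, j)\<in>UNIV. (X $ i $ i / h $ i $ i * trig_casimir_coeff i j h) \<cdot>\<^sub>Y trig_casimir_elt i j)"
  unfolding trig_casimir_form_eq[OF assms] trig_casimir_component_def yangian.scale_sum_right
    sum.cartesian_product by simp

section \<open>Flatness\<close>

text \<open>Coefficientwise differentiation of a sum over any finite index set.\<close>

lemma has_directional_derivative_sum:
  fixes F :: "'n::finite yfunction"
  assumes "finite I"
    and F: "\<And>g. g \<in> torus_reg \<Longrightarrow> F g = (\<Sum>k\<in>I. f k g \<cdot>\<^sub>Y y k)"
    and d: "\<And>k. k \<in> I \<Longrightarrow> ((\<lambda>z. f k (h + mat z ** X)) has_field_derivative d k) (at 0)"
  shows "has_directional_derivative F h X (\<Sum>k\<in>I. d k \<cdot>\<^sub>Y y k)"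
proof -
  obtain p where "bij_betw p {0..<card I} I"
    using ex_bij_betw_nat_finite[OF assms(1)] by blast
  then have p: "bij_betw p {..<card I} I"
    by (simp add: atLeast0LessThan)
  show ?thesis
    unfolding has_directional_derivative_def
  proof (intro exI conjI ballI allI impI)
    show "F g = (\<Sum>k<card I. f (p k) g \<cdot>\<^sub>Y y (p k))" if "g \<in> torus_reg" for g
      using F[OF that] sum.reindex_bij_betw[OF p, of "\<lambda>k. f k g \<cdot>\<^sub>Y y k"] by simp
    show "((\<lambda>z. f (p k) (h + mat z ** X)) has_field_derivative d (p k)) (at 0)"
      if "k < card I" for k
      using d bij_betwE[OF p] that by blast
    show "(\<Sum>k\<in>I. d k \<cdot>\<^sub>Y y k) = (\<Sum>k<card I. d (p k) \<cdot>\<^sub>Y y (p k))"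
      using sum.reindex_bij_betw[OF p, of "\<lambda>k. d k \<cdot>\<^sub>Y y k"] by simp
  qed
qed

text \<open>
  The derivative, at \<open>h\<close> along \<open>Z\<close>, of the coefficient \<open>g \<mapsto> X\<^sub>i\<^sub>i / g\<^sub>i\<^sub>i * trig_casimir_coeff i j g\<close>
  of \<open>trig_casimir_elt i j\<close> in the value of the connection form on the constant vector field \<open>X\<close>.
\<close>

definition trig_casimir_deriv ::
  "complex^'n^'n \<Rightarrow> complex^'n^'n \<Rightarrow> complex^'n^'n \<Rightarrow> 'n \<Rightarrow> 'n \<Rightarrow> complex" where
  "trig_casimir_deriv h X Z i j =
     (if i = j then - (X $ i $ i * Z $ i $ i) / (h $ i $ i)\<^sup>2
      else X $ i $ i * (Z $ j $ j * (h $ i $ i)\<^sup>2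
             - Z $ i $ i * h $ j $ j * (2 * h $ i $ i - h $ j $ j))
           / (h $ i $ i * (h $ i $ i - h $ j $ j))\<^sup>2)"

lemma has_directional_derivative_trig_casimir_form:
  fixes h :: "complex^('n::{finite,linorder})^('n::{finite,linorder})"
  assumes h: "h \<in> torus_reg"
  shows "has_directional_derivative (\<lambda>g. trig_casimir_form g X) h Z
     (\<Sum>(i, j)\<in>UNIV. trig_casimir_deriv h X Z i j \<cdot>\<^sub>Y trig_casimir_elt i j)"
proof -
  have "((\<lambda>z. X $ i $ i / (h + mat z ** Z) $ i $ i * trig_casimir_coeff i j (h + mat z ** Z))
      has_field_derivative trig_casimir_deriv h X Z i j) (at 0)" for i j
  proof (cases "i = j")
    case True
    then show ?thesis
      using torus_entry_nonzero[OF torus_reg_imp_torus[OF h], of i]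
      unfolding trig_casimir_coeff_def trig_casimir_deriv_def
      by (auto intro!: derivative_eq_intros
          simp: mat_mult_component power2_eq_square)
  next
    case False
    then show ?thesis
      using torus_entry_nonzero[OF torus_reg_imp_torus[OF h], of i] torus_reg_entry_neq[OF h False]
      unfolding trig_casimir_coeff_def trig_casimir_deriv_def
      apply (simp add: mat_mult_component)
      apply (rule derivative_eq_intros refl | simp)+
      by (simp add: divide_simps) (simp add: power2_eq_square algebra_simps)
  qed
  then have "has_directional_derivative (\<lambda>g. trig_casimir_form g X) h Z
      (\<Sum>p\<in>UNIV. (case p of (i, j) \<Rightarrow> trig_casimir_deriv h X Z i j) \<cdot>\<^sub>Y
        (case p of (i, j) \<Rightarrow> trig_casimir_elt i j))"
    by (intro has_directional_derivative_sum[where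
          f = "\<lambda>(i, j) g. X $ i $ i / g $ i $ i * trig_casimir_coeff i j g"])
       (auto simp: trig_casimir_form_eq_double_sum split_def)
  then show ?thesis
    by (simp add: split_def)
qed

lemma flat_trig_casimir_form:
  "flat_connection (trig_casimir_form :: 'n::{finite,linorder} yform1)"
proof -
  have "holomorphic_form1 (trig_casimir_form :: 'n yform1)"
    unfolding holomorphic_form1_def
  proof (intro ballI conjI allI)
    fix h X Z :: "((complex, 'n) vec, 'n) vec" and c
    assume h: "h \<in> torus_reg"
    show "trig_casimir_form h (X + Z) = trig_casimir_form h X + trig_casimir_form h Z"
      by (simp add: trig_casimir_form_eq[OF h] add_divide_distrib yangian.scale_left_distrib
          sum.distrib)
    show "trig_casimir_form h (mat c ** X) = c \<cdot>\<^sub>Y trig_casimir_form h X"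
      by (simp add: trig_casimir_form_eq[OF h] mat_mult_component yangian.scale_sum_right)
    show "\<exists>D. has_directional_derivative (\<lambda>g. trig_casimir_form g X) h Z D"
      using has_directional_derivative_trig_casimir_form[OF h] by blast
  qed
  moreover have "curvature trig_casimir_form h X Z = 0"
    if h: "h \<in> torus_reg" and X: "X \<in> diagonal_matrices" and Z: "Z \<in> diagonal_matrices"
    for h X Z :: "((complex, 'n) vec, 'n) vec"
  proof -
    \<comment> \<open>The exterior derivative has coefficients \<open>e\<close> antisymmetric in \<open>i, j\<close> while
      \<open>trig_casimir_elt\<close> is symmetric, so its value \<open>S\<close> equals \<open>- S\<close>.\<close>
    define e where "e = (\<lambda>i j. trig_casimir_deriv h Z X i j - trig_casimir_deriv h X Z i j)"
    define S where "S = (\<Sum>i\<in>UNIV. \<Sum>j\<in>UNIV. e i j \<cdot>\<^sub>Y trig_casimir_elt i j)"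
    have e_eq: "e i j = (if i = j then 0 else
        (Z $ i $ i * X $ j $ j - X $ i $ i * Z $ j $ j) / (h $ i $ i - h $ j $ j)\<^sup>2)" for i j
    proof (cases "i = j")
      case False
      then show ?thesis
        using torus_entry_nonzero[OF torus_reg_imp_torus[OF h], of i]
          torus_reg_entry_neq[OF h False]
        unfolding e_def trig_casimir_deriv_def diff_divide_distrib[symmetric]
        by (simp add: divide_simps) (simp add: power2_eq_square algebra_simps)
    qed (simp add: e_def trig_casimir_deriv_def mult.commute)
    have e_swap: "e j i = - e i j" for i j
      by (simp add: e_eq power2_commute[of "h $ j $ j"] minus_divide_left mult.commute)
    have "S = (\<Sum>j\<in>UNIV. \<Sum>i\<in>UNIV. e i j \<cdot>\<^sub>Y trig_casimir_elt i j)"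
      unfolding S_def by (rule sum.swap)
    also have "\<dots> = - S"
      unfolding S_def sum_negf[symmetric]
      by (intro sum.cong refl) (metis e_swap trig_casimir_elt_commute yangian.scale_minus_left)
    finally have "S + S = 0"
      by (simp add: eq_neg_iff_add_eq_0)
    then have "2 \<cdot>\<^sub>Y S = 0"
      by (simp add: yscale_2)
    then have "S = 0"
      by (simp add: yangian.scale_eq_0_iff)
    have "exterior_derivative trig_casimir_form h X Z = S"
      unfolding exterior_derivative_def
        directional_derivative_eq[OF h X has_directional_derivative_trig_casimir_form[OF h]]
        directional_derivative_eq[OF h Z has_directional_derivative_trig_casimir_form[OF h]]
        S_def e_def sum.cartesian_product UNIV_Times_UNIV sum_subtractf[symmetric]
      by (intro sum.cong refl) (auto simp: yangian.scale_left_diff_distrib)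
    moreover have "wedge trig_casimir_form trig_casimir_form h X Z = 0"
    proof -
      have "comm (trig_casimir_form h X) (trig_casimir_form h Z) = 0"
        by (simp add: trig_casimir_form_eq[OF h] comm_sum_left comm_sum_right comm_yscale_left
            comm_yscale_right comm_trig_casimir_component[OF h])
      then show ?thesis
        by (simp add: wedge_def comm_def)
    qed
    ultimately show ?thesis
      using \<open>S = 0\<close> by (simp add: curvature_def)
  qed
  ultimately show ?thesis
    by (simp add: flat_connection_def)
qed

section \<open>Equivariance\<close>

lemma perm_yangian_yscale: "perm_yangian \<sigma> (c \<cdot>\<^sub>Y y) = c \<cdot>\<^sub>Y perm_yangian \<sigma> y"
  by (simp add: yscale_def perm_yangian_mult perm_yangian_yconst)

lemma perm_yangian_diff: "perm_yangian \<sigma> (x - y) = perm_yangian \<sigma> x - perm_yangian \<sigma> y"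
  using perm_yangian_add[of \<sigma> "x - y" y] by (simp add: eq_diff_eq)

lemma perm_yangian_sum: "perm_yangian \<sigma> (sum f A) = (\<Sum>i\<in>A. perm_yangian \<sigma> (f i))"
proof (induction A rule: infinite_finite_induct)
  case empty
  then show ?case
    using perm_yangian_diff[of \<sigma> 0 0] by simp
qed (use perm_yangian_diff[of \<sigma> 0 0] in \<open>simp_all add: perm_yangian_add\<close>)

lemma perm_yangian_trig_casimir_elt:
  "perm_yangian \<sigma> (trig_casimir_elt i j) =
     trig_casimir_elt (Perm.apply \<sigma> i) (Perm.apply \<sigma> j)"
  by (simp add: trig_casimir_elt_def kappa_def gl_unit_def power2_eq_square perm_yangian_diff
      perm_yangian_add perm_yangian_mult perm_yangian_yscale perm_yangian_ygen
      inj_eq[OF bij_is_inj[OF bij_apply]])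

lemma perm_matrix_act_inverse_diagonal:
  "perm_matrix_act (inverse \<sigma>) h $ i $ i = h $ Perm.apply \<sigma> i $ Perm.apply \<sigma> i"
  by (simp add: perm_matrix_act_def apply_inverse_inverse)

lemma perm_matrix_act_torus_reg:
  fixes h :: "complex^'n^'n"
  assumes "h \<in> torus_reg"
  shows "perm_matrix_act (inverse \<sigma>) h \<in> torus_reg"
  using assms perm_matrix_act_torus[of h "inverse \<sigma>"] bij_is_inj[OF bij_apply[of \<sigma>]]
  by (auto simp: torus_reg_def perm_matrix_act_inverse_diagonal inj_def)

lemma equivariant_trig_casimir_form:
  "equivariant_connection (trig_casimir_form :: 'n::{finite,linorder} yform1)"
  unfolding equivariant_connection_def
proof (intro allI ballI)
  fix \<sigma> :: "'n Perm.perm" and h X :: "((complex, 'n) vec, 'n) vec"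
  assume h: "h \<in> torus_reg"
  let ?s = "Perm.apply \<sigma>"
  have coeff: "trig_casimir_coeff i j (perm_matrix_act (inverse \<sigma>) h) =
      trig_casimir_coeff (?s i) (?s j) h" for i j
    by (simp add: trig_casimir_coeff_def perm_matrix_act_inverse_diagonal
        inj_eq[OF bij_is_inj[OF bij_apply]])
  have reindex: "(\<Sum>i\<in>UNIV. f (?s i)) = sum f UNIV" for f :: "'n \<Rightarrow> 'n yangian"
    by (rule sum.reindex_bij_betw) (rule bij_apply)
  have component: "perm_yangian \<sigma> (trig_casimir_component i (perm_matrix_act (inverse \<sigma>) h)) =
      trig_casimir_component (?s i) h" for i
    unfolding trig_casimir_component_def perm_yangian_sum perm_yangian_yscale coeff
      perm_yangian_trig_casimir_elt
    by (rule reindex)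
  show "perm_form_act \<sigma> trig_casimir_form h X = trig_casimir_form h X"
    unfolding perm_form_act_def trig_casimir_form_eq[OF h]
      trig_casimir_form_eq[OF perm_matrix_act_torus_reg[OF h]] perm_yangian_sum
      perm_yangian_yscale component perm_matrix_act_inverse_diagonal
    by (rule reindex)
qed

theorem theorem5p7:
  shows "flat_connection (trig_casimir_form :: 'n::{finite,linorder} yform1) \<and>
         equivariant_connection (trig_casimir_form :: 'n yform1)"
  using flat_trig_casimir_form equivariant_trig_casimir_form by blast

end
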